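(* Let $\mathcal H$ be a Hilbert space, $\mathcal A\subset\mathcal H$ a non-empty bounded set, and let $f:\mathcal H\to\mathbb R$ be a convex (Fréchet) differentiable function with curvature constant $C_{f,\mathcal A}\in(0,\infty)$ over $\mathcal A$. Let $x^\star\in\arg\min_{x\in\operatorname{conv}(\mathcal A)}f(x)$ and $\delta\in(0,1]$. Then the iterates of the Affine Invariant Frank-Wolfe algorithm, started at $x_0\in\operatorname{conv}(\mathcal A)$ and using an approximate linear minimization oracle of accuracy $\delta$, satisfy for all $t\ge0$ $$f(x_t)-f(x^\star)\le\frac{2\left(\frac1\delta C_{f,\mathcal A}+\varepsilon_0\right)}{\delta t+2},$$ where $\varepsilon_0:=f(x_0)-f(x^\star)$.
   Context: $\operatorname{conv}$ denotes the convex hull, $\operatorname{clip}_{[0,1]}(s)=\max\{0,\min\{1,s\}\}$. With $D(y,x):=f(y)-f(x)-\langle y-x,\nabla f(x)\rangle$, the curvature constant is $$C_{f,\mathcal A}:=\sup_{\substack{s\in\mathcal A,\ x\in\operatorname{conv}(\mathcal A),\ \gamma\in(0,1]\\ y=x+\gamma(s-x)}}\frac{2}{\gamma^2}D(y,x).$$ Approximate oracle of accuracy $\delta$: at each iteration $t$ an atom $z_t\in\mathcal A$ is returned with $$\langle\nabla f(x_t),z_t-x_t\rangle\le\delta\,\min_{z\in\mathcal A}\langle\nabla f(x_t),z-x_t\rangle .$$ Affine Invariant Frank-Wolfe: at each $t\ge0$ obtain $z_t$ from the oracle, set $\gamma:=\operatorname{clip}_{[0,1]}\big[\langle-\nabla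 f(x_t),z_t-x_t\rangle/C_{f,\mathcal A}\big]$ and $x_{t+1}:=x_t+\gamma(z_t-x_t)$. Optionally, after the update, a correction of the previously selected atoms may be performed, i.e. $x_{t+1}$ may be replaced by another point of $\operatorname{conv}(\mathcal A)$ at which $f$ is not larger. *)

theory Defs
  imports "HOL-Analysis.Analysis"
begin

definition clip01 :: "real \<Rightarrow> real" where
  "clip01 s = max 0 (min 1 s)"

definition gradient :: "('a::real_inner \<Rightarrow> real) \<Rightarrow> 'a \<Rightarrow> 'a" where
  "gradient f x = (THE g. GDERIV f x :> g)"

text \<open>
  On a Hilbert space the gradient exists wherever the function is differentiable in the sense
  of Frechet (Riesz representation), so the description operator above is well-defined there.
\<close>

lemma riesz_representation:
  fixes L :: "'a::{real_inner, complete_space} \<Rightarrow> real"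
  assumes "bounded_linear L"
  shows "\<exists>g. \<forall>h. L h = inner h g"
proof -
  interpret L: bounded_linear L by fact
  define \<phi> where "\<phi> x = (norm x)\<^sup>2 / 2 - L x" for x
  obtain K where K: "\<And>x. norm (L x) \<le> norm x * K"
    using L.bounded by blast
  have "- K\<^sup>2 / 2 \<le> \<phi> x" for x
  proof -
    have "L x \<le> norm x * K" using K[of x] by simp
    moreover have "0 \<le> (norm x - K)\<^sup>2" by simp
    ultimately show ?thesis unfolding \<phi>_def by (simp add: power2_diff)
  qed
  then have bdd: "bdd_below (range \<phi>)" by (metis bdd_belowI2)
  define m where "m = Inf (range \<phi>)"
  have m_le: "m \<le> \<phi> x" for x
    unfolding m_def by (rule cInf_lower) (use bdd in auto)
  have "\<exists>x. \<phi> x < m + 1 / real (Suc n)" for n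
    using cInf_lessD[of "range \<phi>" "m + 1 / real (Suc n)"] unfolding m_def by auto
  then obtain X where X: "\<And>n. \<phi> (X n) < m + 1 / real (Suc n)" by metis
  have par: "(norm (x - y))\<^sup>2 / 4 = \<phi> x + \<phi> y - 2 * \<phi> ((1/2) *\<^sub>R (x + y))" for x y
    unfolding \<phi>_def L.scaleR L.add power2_norm_eq_inner
    by (simp add: inner_commute[of y x] algebra_simps add_divide_distrib diff_divide_distrib)
  have "Cauchy X"
  proof (rule metric_CauchyI)
    fix e :: real assume "0 < e"
    then obtain N where N: "1 / real (Suc N) < e\<^sup>2 / 8"
      using reals_Archimedean[of "e\<^sup>2 / 8"] by (auto simp: inverse_eq_divide)
    have "dist (X i) (X j) < e" if "i \<ge> N" "j \<ge> N" for i j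
    proof -
      have le: "1 / real (Suc i) \<le> 1 / real (Suc N)" "1 / real (Suc j) \<le> 1 / real (Suc N)"
        using that by (simp_all add: frac_le)
      have "(norm (X i - X j))\<^sup>2 / 4 < e\<^sup>2 / 4"
        using par[of "X i" "X j"] X[of i] X[of j] m_le[of "(1/2) *\<^sub>R (X i + X j)"] le N
        by linarith
      then have "(norm (X i - X j))\<^sup>2 < e\<^sup>2" by simp
      then show ?thesis
        using \<open>0 < e\<close> by (simp add: dist_norm power2_less_imp_less)
    qed
    then show "\<exists>M. \<forall>i\<ge>M. \<forall>j\<ge>M. dist (X i) (X j) < e" by blast
  qed
  then obtain p where p: "X \<longlonglongrightarrow> p"
    using Cauchy_convergent convergent_def by blast
  have "(\<lambda>n. \<phi> (X n)) \<longlonglongrightarrow> \<phi> p"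
    unfolding \<phi>_def by (intro tendsto_intros p L.tendsto) simp
  moreover have "(\<lambda>n. m + 1 / real (Suc n)) \<longlonglongrightarrow> m + 0"
    by (intro tendsto_intros LIMSEQ_Suc lim_1_over_n)
  ultimately have "\<phi> p \<le> m + 0"
    by (rule LIMSEQ_le) (use X less_imp_le in blast)
  then have \<phi>p: "\<phi> p \<le> m" by simp
  have "L h = inner h p" for h
  proof (rule ccontr)
    define c where "c = inner h p - L h"
    define k where "k = (norm h)\<^sup>2 + 1"
    assume "L h \<noteq> inner h p"
    then have c: "c\<^sup>2 > 0" unfolding c_def by simp
    have k: "k > 0" unfolding k_def by (simp add: add_nonneg_pos)
    have "\<phi> (p + t *\<^sub>R h) = \<phi> p + t * c + t\<^sup>2 * (k - 1) / 2" for t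
      unfolding \<phi>_def c_def k_def L.scaleR L.add power2_norm_eq_inner
      by (simp add: inner_commute[of p h] algebra_simps power2_eq_square add_divide_distrib)
    from this[of "- c / k"] have "0 \<le> (- c / k) * c + (- c / k)\<^sup>2 * (k - 1) / 2"
      using \<phi>p m_le[of "p + (- c / k) *\<^sub>R h"] by linarith
    also have "\<dots> = - (c\<^sup>2 * (k + 1) / (2 * k\<^sup>2))"
      using k by (simp add: field_simps power2_eq_square)
    also have "\<dots> < 0"
      using c k by simp
    finally show False by simp
  qed
  then show ?thesis by blast
qed

lemma GDERIV_gradient:
  fixes f :: "'a::{real_inner, complete_space} \<Rightarrow> real"
  assumes "f differentiable (at x)"
  shows "GDERIV f x :> gradient f x"
proof -
  obtain L where L: "(f has_derivative L) (at x)"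
    using assms differentiable_def by blast
  obtain g where g: "\<And>h. L h = inner h g"
    using riesz_representation[OF has_derivative_bounded_linear[OF L]] by blast
  then have "L = (\<lambda>h. inner h g)" by blast
  then have "GDERIV f x :> g" using L unfolding gderiv_def by simp
  moreover have "g' = g" if "GDERIV f x :> g'" for g'
  proof -
    have "(\<lambda>h. inner h g') = L"
      using that L unfolding gderiv_def by (rule has_derivative_unique)
    then have "inner (g' - g) (g' - g) = 0"
      using g by (metis inner_diff_right right_minus_eq)
    then show ?thesis by simp
  qed
  ultimately show ?thesis unfolding gradient_def by (rule theI)
qed

definition linearization_gap :: "('a::real_inner \<Rightarrow> real) \<Rightarrow> 'a \<Rightarrow> 'a \<Rightarrow> real" where
  "linearization_gap f y x = f y - f x - inner (y - x) (gradient f x)"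

text \<open>The supremum is taken in the extended reals, so that finiteness is a genuine condition.\<close>

definition curvature_constant :: "('a::real_inner \<Rightarrow> real) \<Rightarrow> 'a set \<Rightarrow> ereal" where
  "curvature_constant f A =
     Sup {ereal (2 / \<gamma>\<^sup>2 * linearization_gap f y x) | s x \<gamma> y.
            s \<in> A \<and> x \<in> convex hull A \<and> \<gamma> \<in> {0<..1} \<and> y = x + \<gamma> *\<^sub>R (s - x)}"

text \<open>
  The minimum over the atoms is rendered as an infimum: the set of atoms need not be closed,
  and the two agree whenever the minimum is attained.
\<close>

definition approx_oracle ::
    "('a::real_inner \<Rightarrow> real) \<Rightarrow> 'a set \<Rightarrow> real \<Rightarrow> 'a \<Rightarrow> 'a \<Rightarrow> bool" where
  "approx_oracle f A \<delta> x z \<longleftrightarrow>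
     z \<in> A \<and>
     inner (gradient f x) (z - x) \<le> \<delta> * (INF w\<in>A. inner (gradient f x) (w - x))"

definition fw_step :: "('a::real_inner \<Rightarrow> real) \<Rightarrow> 'a set \<Rightarrow> 'a \<Rightarrow> 'a \<Rightarrow> 'a" where
  "fw_step f A x z =
     x + clip01 (inner (- gradient f x) (z - x) / real_of_ereal (curvature_constant f A))
           *\<^sub>R (z - x)"

text \<open>
  \<open>x\<close> is the sequence of iterates and \<open>z\<close> the sequence of atoms returned by the oracle. The
  second disjunct is the optional correction, which may or may not be performed at each step.
\<close>

definition affine_invariant_fw ::
    "('a::real_inner \<Rightarrow> real) \<Rightarrow> 'a set \<Rightarrow> real \<Rightarrow> (nat \<Rightarrow> 'a) \<Rightarrow> (nat \<Rightarrow> 'a) \<Rightarrow> bool" where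
  "affine_invariant_fw f A \<delta> x z \<longleftrightarrow>
     x 0 \<in> convex hull A \<and>
     (\<forall>t. approx_oracle f A \<delta> (x t) (z t) \<and>
          (x (Suc t) = fw_step f A (x t) (z t) \<or>
           x (Suc t) \<in> convex hull A \<and> f (x (Suc t)) \<le> f (fw_step f A (x t) (z t))))"

end

theory Submission
  imports Defs
begin

text \<open>
  Let \<open>h\<^sub>t\<close> be the primal gap of \<open>x t\<close> and \<open>C\<close> the curvature constant. Convexity and the accuracy
  of the chosen atom give \<open>\<langle>-\<nabla>f (x t), z t - x t\<rangle> \<ge> \<delta> h\<^sub>t\<close>. The clipped step size minimises over
  \<open>[0,1]\<close> the quadratic upper bound supplied by the curvature constant, so the next gap is at
  most \<open>(1 - \<gamma>\<delta>) h\<^sub>t + \<gamma>\<^sup>2 C / 2\<close> for every \<open>\<gamma> \<in> [0,1]\<close>. Taking \<open>\<gamma> = 2 / (\<delta>t + 2)\<close> yields the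
  rate by induction on \<open>t\<close>.
\<close>

lemma clip01_bounds: "0 \<le> clip01 s" "clip01 s \<le> 1"
  by (auto simp: clip01_def)

text \<open>The parabola has its vertex at \<open>g / C\<close>, which is nonnegative, so clipping
  matters only when the vertex lies beyond 1. Otherwise the excess over the minimum is a complete
  square.\<close>

lemma clip01_minimizes_quadratic:
  fixes C g \<gamma> :: real
  assumes "0 < C" "0 \<le> g" "0 \<le> \<gamma>" "\<gamma> \<le> 1"
  shows "- clip01 (g / C) * g + (clip01 (g / C))\<^sup>2 * C / 2 \<le> - \<gamma> * g + \<gamma>\<^sup>2 * C / 2"
proof (cases "C \<le> g")
  case True
  then have "clip01 (g / C) = 1"
    using assms by (simp add: clip01_def)
  \<comment> \<open>This expression is exactly the right-hand side of the goal minus its left-hand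
    side at step size 1.\<close>
  moreover have "0 \<le> (1 - \<gamma>) * (g - C) + C * (1 - \<gamma>)\<^sup>2 / 2"
    using assms True by (intro add_nonneg_nonneg) auto
  ultimately show ?thesis
    by (simp add: power2_eq_square field_simps)
next
  case False
  then have "clip01 (g / C) = g / C"
    using assms by (simp add: clip01_def)
  moreover have "- \<gamma> * g + \<gamma>\<^sup>2 * C / 2 - (- (g / C) * g + (g / C)\<^sup>2 * C / 2) = C * (\<gamma> - g / C)\<^sup>2 / 2"
    using assms by (simp add: power2_eq_square field_simps)
  moreover have "0 \<le> C * (\<gamma> - g / C)\<^sup>2 / 2"
    using assms by simp
  ultimately show ?thesis
    by (simp only:)
qed

text \<open>Restricting \<open>f\<close> to the line through \<open>x\<close> and \<open>y\<close>
  reduces the claim to one real variable: the tangent at parameter 0 lies below the graph at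
  parameter 1.\<close>

lemma convex_on_gradient_le:
  fixes f :: "'a::{real_inner, complete_space} \<Rightarrow> real"
  assumes "convex_on UNIV f" "f differentiable (at x)"
  shows "inner (gradient f x) (y - x) \<le> f y - f x"
proof -
  define \<phi> where "\<phi> t = f (x + t *\<^sub>R (y - x))" for t :: real
  \<comment> \<open>The base point is written with a zero multiple so that it matches the inner
    function of the chain rule at 0.\<close>
  have "(f has_derivative (\<lambda>h. inner h (gradient f x))) (at (x + 0 *\<^sub>R (y - x)))"
    using GDERIV_gradient[OF assms(2)] by (simp add: gderiv_def)
  moreover have "((\<lambda>t. x + t *\<^sub>R (y - x)) has_derivative (\<lambda>t. t *\<^sub>R (y - x))) (at 0)"
    by (auto intro!: derivative_eq_intros)
  ultimately have "(\<phi> has_derivative (\<lambda>t. inner (t *\<^sub>R (y - x)) (gradient f x))) (at 0)"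
    unfolding \<phi>_def by (rule has_derivative_compose[rotated])
  then have der: "(\<phi> has_real_derivative inner (gradient f x) (y - x)) (at 0)"
    by (simp add: has_field_derivative_def inner_commute mult.commute[of _ "inner _ _"])
  have "convex_on UNIV \<phi>"
  proof (rule convex_onI)
    fix t a b :: real
    assume "0 < t" "t < 1"
    moreover have "x + ((1 - t) *\<^sub>R a + t *\<^sub>R b) *\<^sub>R (y - x)
        = (1 - t) *\<^sub>R (x + a *\<^sub>R (y - x)) + t *\<^sub>R (x + b *\<^sub>R (y - x))"
      by (simp add: algebra_simps)
    ultimately show "\<phi> ((1 - t) *\<^sub>R a + t *\<^sub>R b) \<le> (1 - t) * \<phi> a + t * \<phi> b"
      unfolding \<phi>_def by (simp only:) (rule convex_onD[OF assms(1)], auto)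
  qed auto
  from convex_on_imp_above_tangent[OF this _ _ _ der, of 1]
  show ?thesis by (simp add: \<phi>_def)
qed

text \<open>A half-space that contains \<open>A\<close> contains its convex hull. Boundedness enters
  through Cauchy-Schwarz: a real \<open>INF\<close> is a lower bound only once the values are known
  to be bounded below.\<close>

lemma INF_inner_le_convex_hull:
  fixes g :: "'a::real_inner"
  assumes "bounded A" "y \<in> convex hull A"
  shows "(INF w\<in>A. inner g (w - x)) \<le> inner g (y - x)"
proof -
  define m where "m = (INF w\<in>A. inner g (w - x))"
  obtain K where K: "\<And>w. w \<in> A \<Longrightarrow> norm w \<le> K"
    using assms(1) bounded_iff by blast
  have "- (norm g * (K + norm x)) \<le> inner g (w - x)" if "w \<in> A" for w
  proof -
    have "norm (w - x) \<le> K + norm x"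
      using K[OF that] norm_triangle_ineq4[of w x] by linarith
    then have "norm g * norm (w - x) \<le> norm g * (K + norm x)"
      by (rule mult_left_mono) simp
    then show ?thesis
      using Cauchy_Schwarz_ineq2[of g "w - x"] by linarith
  qed
  then have "bdd_below ((\<lambda>w. inner g (w - x)) ` A)"
    by (rule bdd_belowI2)
  then have "m \<le> inner g (w - x)" if "w \<in> A" for w
    unfolding m_def using that by (rule cINF_lower)
  then have "A \<subseteq> {w. inner g w \<ge> m + inner g x}"
    by (force simp: inner_diff_right)
  then have "convex hull A \<subseteq> {w. inner g w \<ge> m + inner g x}"
    by (rule hull_minimal) (rule convex_halfspace_ge)
  then show ?thesis
    using assms(2) by (auto simp: m_def inner_diff_right)
qed

lemma convex_hull_step:
  assumes "x \<in> convex hull A" "z \<in> A" "0 \<le> \<gamma>" "\<gamma> \<le> 1"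
  shows "x + \<gamma> *\<^sub>R (z - x) \<in> convex hull A"
proof -
  have "(1 - \<gamma>) *\<^sub>R x + \<gamma> *\<^sub>R z \<in> convex hull A"
    using assms by (intro convexD[OF convex_convex_hull]) (auto intro: hull_inc)
  then show ?thesis
    by (simp add: algebra_simps)
qed

lemma fw_step_in_convex_hull:
  assumes "x \<in> convex hull A" "z \<in> A"
  shows "fw_step f A x z \<in> convex hull A"
  unfolding fw_step_def using assms by (intro convex_hull_step clip01_bounds)

text \<open>For positive \<gamma> this is one member of the family in the supremum, solved for
  \<open>f y\<close>. The supremum leaves out \<gamma> = 0, where the bound is trivial.\<close>

lemma curvature_quadratic_bound:
  fixes f :: "'a::real_inner \<Rightarrow> real"
  assumes "x \<in> convex hull A" "z \<in> A" "0 \<le> \<gamma>" "\<gamma> \<le> 1"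
    and "0 < curvature_constant f A" "curvature_constant f A < \<infinity>"
  shows "f (x + \<gamma> *\<^sub>R (z - x))
    \<le> f x + \<gamma> * inner (gradient f x) (z - x) + \<gamma>\<^sup>2 * real_of_ereal (curvature_constant f A) / 2"
proof (cases "\<gamma> = 0")
  case False
  define y where "y = x + \<gamma> *\<^sub>R (z - x)"
  have "ereal (2 / \<gamma>\<^sup>2 * linearization_gap f y x) \<le> curvature_constant f A"
    unfolding curvature_constant_def y_def
    by (rule Sup_upper) (use assms False in force)
  \<comment> \<open>\<open>real_of_ereal\<close> sends both infinities to 0, so positivity and
    finiteness are what allow the passage to the reals.\<close>
  then have "2 / \<gamma>\<^sup>2 * linearization_gap f y x \<le> real_of_ereal (curvature_constant f A)"
    using assms(5,6) by (cases "curvature_constant f A") auto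
  then have "linearization_gap f y x \<le> \<gamma>\<^sup>2 * real_of_ereal (curvature_constant f A) / 2"
    using False by (simp add: field_simps)
  then show ?thesis
    by (simp add: linearization_gap_def y_def inner_commute)
qed simp

lemma fw_step_progress:
  fixes f :: "'a::{real_inner, complete_space} \<Rightarrow> real"
  assumes "bounded A" "convex_on UNIV f" "f differentiable (at x)"
    and "0 < curvature_constant f A" "curvature_constant f A < \<infinity>"
    and "x \<in> convex hull A" "y \<in> convex hull A" "f y \<le> f x"
    and "0 \<le> \<delta>" "approx_oracle f A \<delta> x z" "0 \<le> \<gamma>" "\<gamma> \<le> 1"
  shows "f (fw_step f A x z) - f y
    \<le> (1 - \<gamma> * \<delta>) * (f x - f y) + \<gamma>\<^sup>2 * real_of_ereal (curvature_constant f A) / 2"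
proof -
  define C where "C = real_of_ereal (curvature_constant f A)"
  define g where "g = inner (- gradient f x) (z - x)"
  define c where "c = clip01 (g / C)"
  have "0 < C"
    unfolding C_def using assms(4,5) by (cases "curvature_constant f A") auto
  have "z \<in> A" and "- g \<le> \<delta> * (INF w\<in>A. inner (gradient f x) (w - x))"
    using assms(10) by (auto simp: approx_oracle_def g_def)
  note this(2)
  \<comment> \<open>The infimum over atoms is at most the slope towards the hull point
    \<open>y\<close>, which convexity bounds by \<open>f y - f x\<close>.\<close>
  also have "\<dots> \<le> \<delta> * (f y - f x)"
    using INF_inner_le_convex_hull[OF assms(1,7), of "gradient f x" x]
      convex_on_gradient_le[OF assms(2,3), of y] \<open>0 \<le> \<delta>\<close>
    by (intro mult_left_mono) auto
  finally have g: "\<delta> * (f x - f y) \<le> g"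
    by (simp add: algebra_simps)
  \<comment> \<open>With the previous bound this makes \<open>g\<close> nonnegative, so the lower
    clip at 0 changes nothing.\<close>
  moreover have "0 \<le> \<delta> * (f x - f y)"
    using assms(8,9) by simp
  ultimately have "0 \<le> g" by linarith
  have "f (fw_step f A x z) \<le> f x + (- c * g + c\<^sup>2 * C / 2)"
    using curvature_quadratic_bound[OF assms(6) \<open>z \<in> A\<close> clip01_bounds assms(4,5), of "g / C"]
    by (simp add: fw_step_def c_def g_def C_def)
  also have "\<dots> \<le> f x + (- \<gamma> * g + \<gamma>\<^sup>2 * C / 2)"
    unfolding c_def
    using clip01_minimizes_quadratic[OF \<open>0 < C\<close> \<open>0 \<le> g\<close> assms(11,12)] by simp
  also have "\<dots> \<le> f x + (- \<gamma> * (\<delta> * (f x - f y)) + \<gamma>\<^sup>2 * C / 2)"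
    using mult_left_mono[OF g assms(11)] by simp
  finally show ?thesis
    by (simp add: C_def algebra_simps)
qed

text \<open>Since \<gamma> is free in the recurrence, it may depend on \<open>t\<close>; the choice
  is 2 over the current denominator. In the numerator, \<open>h 0\<close> covers the base case and
  \<open>C\<close> / \<delta> absorbs the quadratic term.\<close>

lemma sublinear_rate_recurrence:
  fixes h :: "nat \<Rightarrow> real"
  assumes "0 \<le> C" "0 < \<delta>" "\<delta> \<le> 1" "0 \<le> h 0"
    and rec: "\<And>t \<gamma>. 0 \<le> \<gamma> \<Longrightarrow> \<gamma> \<le> 1 \<Longrightarrow> h (Suc t) \<le> (1 - \<gamma> * \<delta>) * h t + \<gamma>\<^sup>2 * C / 2"
  shows "h t \<le> 2 * (1 / \<delta> * C + h 0) / (\<delta> * real t + 2)"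
proof (induction t)
  case 0
  then show ?case using assms by simp
next
  case (Suc t)
  define B where "B = 1 / \<delta> * C + h 0"
  define T where "T = \<delta> * real t + 2"
  have "0 \<le> B" "C \<le> \<delta> * B" "2 \<le> T"
    using assms by (simp_all add: B_def T_def field_simps)
  have "h (Suc t) \<le> (1 - 2 / T * \<delta>) * h t + (2 / T)\<^sup>2 * C / 2"
    using \<open>2 \<le> T\<close> by (intro rec) auto
  also have "\<dots> \<le> (1 - 2 / T * \<delta>) * (2 * B / T) + (2 / T)\<^sup>2 * (\<delta> * B) / 2"
  proof (intro add_mono mult_left_mono divide_right_mono)
    \<comment> \<open>The induction hypothesis may be inserted only if its coefficient is
      nonnegative; this is where \<delta> \<le> 1 is used.\<close>
    have "2 * \<delta> \<le> T"
      using \<open>2 \<le> T\<close> \<open>\<delta> \<le> 1\<close> by linarith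
    then show "0 \<le> 1 - 2 / T * \<delta>"
      using \<open>2 \<le> T\<close> by (simp add: field_simps)
  qed (use Suc \<open>C \<le> \<delta> * B\<close> in \<open>auto simp: B_def T_def\<close>)
  also have "\<dots> = 2 * B * ((T - \<delta>) / T\<^sup>2)"
    using \<open>2 \<le> T\<close> by (simp add: field_simps power2_eq_square)
  also have "\<dots> \<le> 2 * B * (1 / (T + \<delta>))"
  proof (rule mult_left_mono)
    \<comment> \<open>A difference of squares; \<open>T + \<delta>\<close> is the denominator for
      \<open>Suc t\<close>.\<close>
    have "(T - \<delta>) * (T + \<delta>) \<le> T\<^sup>2"
      by (simp add: power2_eq_square algebra_simps)
    then show "(T - \<delta>) / T\<^sup>2 \<le> 1 / (T + \<delta>)"
      using \<open>2 \<le> T\<close> \<open>0 < \<delta>\<close> by (simp add: divide_simps)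
  qed (use \<open>0 \<le> B\<close> in simp)
  also have "\<dots> = 2 * B / (\<delta> * real (Suc t) + 2)"
    by (simp add: T_def algebra_simps)
  finally show ?case
    by (simp add: B_def)
qed

theorem theorem11:
  fixes f :: "'a::{real_inner, complete_space} \<Rightarrow> real"
    and A :: "'a set"
    and x z :: "nat \<Rightarrow> 'a"
    and xstar :: 'a
    and \<delta> :: real
  assumes "A \<noteq> {}" and "bounded A"
    and "convex_on UNIV f"
    and "\<forall>y. f differentiable (at y)"
    and "0 < curvature_constant f A" and "curvature_constant f A < \<infinity>"
    and "is_arg_min f (\<lambda>y. y \<in> convex hull A) xstar"
    and "0 < \<delta>" and "\<delta> \<le> 1"
    and "affine_invariant_fw f A \<delta> x z"
  shows "\<forall>t::nat. f (x t) - f xstar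
           \<le> 2 * (1 / \<delta> * real_of_ereal (curvature_constant f A) + (f (x 0) - f xstar))
               / (\<delta> * real t + 2)"
proof -
  have approx: "approx_oracle f A \<delta> (x t) (z t)" for t
    using assms(10) by (simp add: affine_invariant_fw_def)
  have in_hull: "x t \<in> convex hull A" for t
  proof (induction t)
    case (Suc t)
    then have "fw_step f A (x t) (z t) \<in> convex hull A"
      using approx[of t] by (simp add: fw_step_in_convex_hull approx_oracle_def)
    then show ?case
      using assms(10) by (metis affine_invariant_fw_def)
  qed (use assms(10) in \<open>simp add: affine_invariant_fw_def\<close>)
  have xstar: "xstar \<in> convex hull A" "\<And>y. y \<in> convex hull A \<Longrightarrow> f xstar \<le> f y"
    using assms(7) by (auto simp: is_arg_min_linorder)
  \<comment> \<open>This inequality covers the plain step, with equality, and the corrected one, so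
    the two need no separate treatment below.\<close>
  have step: "f (x (Suc t)) \<le> f (fw_step f A (x t) (z t))" for t
    using assms(10) by (metis affine_invariant_fw_def order_refl)
  have "f (x (Suc t)) - f xstar \<le> (1 - \<gamma> * \<delta>) * (f (x t) - f xstar)
      + \<gamma>\<^sup>2 * real_of_ereal (curvature_constant f A) / 2"
    if "0 \<le> \<gamma>" "\<gamma> \<le> 1" for t \<gamma>
    using step[of t]
      fw_step_progress[OF assms(2,3) _ assms(5,6) in_hull xstar(1) xstar(2)[OF in_hull]
        _ approx that] assms(4,8)
    by (smt (verit))
  moreover have "0 \<le> real_of_ereal (curvature_constant f A)"
    using assms(5) by (simp add: real_of_ereal_pos)
  ultimately show ?thesis
    using sublinear_rate_recurrence[OF _ assms(8,9), of _ "\<lambda>t. f (x t) - f xstar"]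
      xstar(2)[OF in_hull, of 0]
    by simp
qed

end
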